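(* For all integers $2\le k\le t$, $$f_k^t=(-1)^{k-1}\frac{N_3^{t-k+1}}{D_t},\qquad g_k^t=(-1)^{k}\frac{N_2^{t-k}}{D_t},\qquad h_k^t=(-1)^{k-1}\frac{N_2^{t-k+1}}{D_t}.$$
   Context: A partial Łukasiewicz path of length $n\ge 0$ is a lattice path starting at $(0,0)$, consisting of $n$ steps from $\{(1,j): j\ge -1\}$, and never going below the $x$-axis. Its height is the maximal $y$-coordinate of its points. The step $(1,-1)$ is a down-step, $(1,0)$ is a horizontal step, and $(1,j)$ with $j\ge1$ is an up-step. For $0\le k\le t$, $f_k^t$ (resp. $g_k^t$, $h_k^t$) is the generating function in $z$ in which the coefficient of $z^n$ is the number of partial Łukasiewicz paths of length $n$ and of height at most $t$, ending at height ($y$-coordinate) $k$, whose last step is an up-step (resp. a down-step, a horizontal step); the empty path is counted in $f_0^t$, so $f_0^t=1$. The polynomials $D_t,N_2^t,N_3^t\in\mathbb{Z}[z]$ ($t\ge0$; the superscript is an index, not a power) each satisfy the recurrence $X_{t+2}+X_{t+1}+zX_t=0$ for $t\ge0$, with initial values $D_0=z-1,\ D_1=1-2z$; $\ N_2^0=0,\ N_2^1=z^2$; $\ N_3^0=-z,\ N_3^1=z(1-z)$. (They arise from Cramer's rule applied to the linear system for the $f_k^t,g_k^t,h_k^t$, $D_t$ being the determinant of the system.) *)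

theory Defs
  imports "HOL-Computational_Algebra.Computational_Algebra"
begin

text \<open>
  A path of length \<open>n\<close> starting at the origin is encoded by the list of the \<open>n\<close> vertical
  components \<open>j\<close> of its steps \<open>(1, j)\<close>; its points are \<open>(i, ordinates w ! i)\<close> for \<open>i \<le> n\<close>.
\<close>

definition ordinates :: "int list \<Rightarrow> int list" where
  "ordinates w = map (\<lambda>i. sum_list (take i w)) [0..<Suc (length w)]"

definition lukasiewicz_path :: "int list \<Rightarrow> bool" where
  "lukasiewicz_path w \<longleftrightarrow> (\<forall>j \<in> set w. j \<ge> -1) \<and> (\<forall>y \<in> set (ordinates w). y \<ge> 0)"

definition path_height :: "int list \<Rightarrow> int" where
  "path_height w = Max (set (ordinates w))"

definition end_height :: "int list \<Rightarrow> int" where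
  "end_height w = last (ordinates w)"

definition luk_paths :: "nat \<Rightarrow> nat \<Rightarrow> nat \<Rightarrow> int list set" where
  "luk_paths t k n = {w. lukasiewicz_path w \<and> length w = n \<and>
     path_height w \<le> int t \<and> end_height w = int k}"

text \<open>The generating functions. The empty path ends at height 0 and is counted by \<open>gf_f 0 t\<close> only.\<close>

definition gf_f :: "nat \<Rightarrow> nat \<Rightarrow> rat fps" where
  "gf_f k t = Abs_fps (\<lambda>n. of_nat (card {w \<in> luk_paths t k n. w = [] \<or> last w \<ge> 1}))"

definition gf_g :: "nat \<Rightarrow> nat \<Rightarrow> rat fps" where
  "gf_g k t = Abs_fps (\<lambda>n. of_nat (card {w \<in> luk_paths t k n. w \<noteq> [] \<and> last w = -1}))"

definition gf_h :: "nat \<Rightarrow> nat \<Rightarrow> rat fps" where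
  "gf_h k t = Abs_fps (\<lambda>n. of_nat (card {w \<in> luk_paths t k n. w \<noteq> [] \<and> last w = 0}))"

fun poly_D :: "nat \<Rightarrow> int poly" where
  "poly_D 0 = [:-1, 1:]"
| "poly_D (Suc 0) = [:1, -2:]"
| "poly_D (Suc (Suc t)) = - poly_D (Suc t) - [:0, 1:] * poly_D t"

fun poly_N2 :: "nat \<Rightarrow> int poly" where
  "poly_N2 0 = 0"
| "poly_N2 (Suc 0) = [:0, 0, 1:]"
| "poly_N2 (Suc (Suc t)) = - poly_N2 (Suc t) - [:0, 1:] * poly_N2 t"

fun poly_N3 :: "nat \<Rightarrow> int poly" where
  "poly_N3 0 = [:0, -1:]"
| "poly_N3 (Suc 0) = [:0, 1, -1:]"
| "poly_N3 (Suc (Suc t)) = - poly_N3 (Suc t) - [:0, 1:] * poly_N3 t"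

definition fps_of_int_poly :: "int poly \<Rightarrow> rat fps" where
  "fps_of_int_poly p = fps_of_poly (map_poly of_int p)"

text \<open>
  Well-definedness: the path sets are finite, so \<open>card\<close> really counts them, and \<open>poly_D t\<close> is
  invertible as a power series, so the quotients by it are genuine.
\<close>

lemma finite_luk_paths: "finite (luk_paths t k n)"
proof (rule finite_subset)
  show "luk_paths t k n \<subseteq> {w. set w \<subseteq> {-1..int t} \<and> length w = n}"
  proof (safe, goal_cases)
    case (1 w j)
    then have w: "lukasiewicz_path w" "path_height w \<le> int t"
      by (auto simp: luk_paths_def)
    from 1 obtain i where i: "i < length w" "j = w ! i"
      by (auto simp: in_set_conv_nth)
    have pt: "0 \<le> sum_list (take m w) \<and> sum_list (take m w) \<le> int t" if "m \<le> length w" for m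
    proof -
      have mem: "sum_list (take m w) \<in> set (ordinates w)"
        using that by (auto simp: ordinates_def simp del: upt_Suc)
      have "sum_list (take m w) \<le> path_height w"
        unfolding path_height_def by (rule Max_ge) (use mem in auto)
      with mem w show ?thesis by (auto simp: lukasiewicz_path_def)
    qed
    have "sum_list (take (Suc i) w) = sum_list (take i w) + j"
      using i by (simp add: take_Suc_conv_app_nth)
    moreover have "-1 \<le> j" using w i by (auto simp: lukasiewicz_path_def)
    ultimately show ?case using pt[of i] pt[of "Suc i"] i by auto
  next
    case (2 w)
    then show ?case by (simp add: luk_paths_def)
  qed
  show "finite {w. set w \<subseteq> {-1..int t} \<and> length w = n}"
    by (rule finite_lists_length_eq) simp
qed

lemma coeff_poly_D_0: "coeff (poly_D t) 0 = (-1) ^ Suc t"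
  by (induction t rule: poly_D.induct) (auto simp: coeff_mult)

lemma fps_nth_poly_D_0: "fps_nth (fps_of_int_poly (poly_D t)) 0 \<noteq> 0"
  by (simp add: fps_of_int_poly_def coeff_map_poly coeff_poly_D_0)

end

theory Submission
  imports Defs
begin

text \<open>
  Write \<open>s k\<close> for the generating function of all paths of height at most \<open>t\<close> that end at
  height \<open>k\<close>. Deleting the last step of a nonempty path gives a path in the same strip that
  ends at some height \<open>i \<le> k + 1\<close>, and every such path arises exactly once, because the
  deleted step is forced to be \<open>k - i\<close> (lemma \<open>gf_by_last_step\<close>). Hence for \<open>1 \<le> k \<le> t\<close>

  \<open>f k = X * (\<Sum>i<k. s i)\<close>,   \<open>g k = X * s (k + 1)\<close>,   \<open>h k = X * s k\<close>,
  and \<open>s k = [k = 0] + X * (\<Sum>i\<le>k+1. s i)\<close> for every \<open>k \<le> t\<close>.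

  Subtracting consecutive equations of the last kind leaves the three-term recurrence
  \<open>s k = s (k + 1) - X * s (k + 2)\<close>, valid from height \<open>1\<close> upwards. It is, up to signs, the
  recurrence of the polynomials \<open>N2\<close> read downwards from the top of the strip. As
  \<open>s (t + 1) = 0\<close>, it shows that \<open>X^2 * s k\<close> with \<open>k \<ge> 1\<close> is, up to sign, \<open>N2\<close> at
  index \<open>t + 1 - k\<close> times \<open>s t\<close> (lemma \<open>path_gf_descent\<close>). The equations at heights \<open>0\<close> and \<open>1\<close> then fix
  \<open>s t\<close>: the combination of \<open>N2\<close> that appears in them equals \<open>X^2 * D\<close>
  (lemma \<open>D_from_N2\<close>). So \<open>X * s k * D t\<close> is \<open>N2\<close> up to sign
  (lemma \<open>path_gf_closed_form\<close>), which is the formula for \<open>h\<close> and, one height further up,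
  the one for \<open>g\<close>. Finally, for \<open>k \<ge> 2\<close> the equation at height \<open>k - 1\<close> reads
  \<open>s (k - 1) = f k + X * s k\<close>, so \<open>f k\<close> too is a combination of two values of \<open>N2\<close>;
  lemma \<open>N3_from_N2\<close> identifies this combination as \<open>N3\<close>.
\<close>

section \<open>Removing the last step\<close>

lemma set_ordinates_snoc:
  "set (ordinates (w @ [j])) = insert (sum_list w + j) (set (ordinates w))"
proof -
  have "map (\<lambda>i. sum_list (take i (w @ [j]))) [0..<Suc (length w)] = ordinates w"
    unfolding ordinates_def by (rule map_cong) auto
  moreover have "ordinates (w @ [j]) =
      map (\<lambda>i. sum_list (take i (w @ [j]))) [0..<Suc (length w)] @ [sum_list w + j]"
    unfolding ordinates_def by simp
  ultimately show ?thesis by simp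
qed

lemma end_height_eq_sum_list: "end_height w = sum_list w"
  by (simp add: end_height_def ordinates_def)

lemma path_height_snoc: "path_height (w @ [j]) = max (sum_list w + j) (path_height w)"
proof -
  have "set (ordinates w) \<noteq> {}" by (simp add: ordinates_def)
  then show ?thesis by (simp add: path_height_def set_ordinates_snoc)
qed

lemma end_height_bounds:
  assumes "lukasiewicz_path w"
  shows "0 \<le> sum_list w" "sum_list w \<le> path_height w"
proof -
  have "sum_list w \<in> set (ordinates w)" by (simp add: ordinates_def)
  then show "0 \<le> sum_list w" "sum_list w \<le> path_height w"
    using assms by (auto simp: lukasiewicz_path_def path_height_def)
qed

lemma luk_paths_above: "t < k \<Longrightarrow> luk_paths t k n = {}"
  using end_height_bounds(2) by (fastforce simp: luk_paths_def end_height_eq_sum_list)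

lemma luk_paths_length_0: "luk_paths t k 0 = (if k = 0 then {[]} else {})"
  by (auto simp: luk_paths_def lukasiewicz_path_def ordinates_def end_height_def path_height_def)

lemma snoc_in_luk_paths_iff:
  assumes "k \<le> t"
  shows "v @ [j] \<in> luk_paths t k (Suc n) \<longleftrightarrow>
    (\<exists>i \<le> k + 1. j = int k - int i \<and> v \<in> luk_paths t i n)"
proof
  assume "v @ [j] \<in> luk_paths t k (Suc n)"
  then have v: "lukasiewicz_path v" "length v = n" "path_height v \<le> int t"
    and j: "-1 \<le> j" "sum_list v + j = int k"
    by (auto simp: luk_paths_def lukasiewicz_path_def set_ordinates_snoc path_height_snoc
        end_height_eq_sum_list)
  have "v \<in> luk_paths t (nat (sum_list v)) n"
    using v end_height_bounds(1)[of v] by (simp add: luk_paths_def end_height_eq_sum_list)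
  then show "\<exists>i \<le> k + 1. j = int k - int i \<and> v \<in> luk_paths t i n"
    using j end_height_bounds(1)[OF v(1)] by (intro exI[of _ "nat (sum_list v)"]) auto
next
  assume "\<exists>i \<le> k + 1. j = int k - int i \<and> v \<in> luk_paths t i n"
  then show "v @ [j] \<in> luk_paths t k (Suc n)"
    using assms
    by (auto simp: luk_paths_def lukasiewicz_path_def set_ordinates_snoc path_height_snoc
        end_height_eq_sum_list)
qed

lemma card_luk_paths_last:
  assumes "k \<le> t"
  shows "card {w \<in> luk_paths t k (Suc n). P (last w)} =
    (\<Sum>i | i \<le> k + 1 \<and> P (int k - int i). card (luk_paths t i n))"
proof -
  let ?I = "{i. i \<le> k + 1 \<and> P (int k - int i)}"
  let ?ext = "\<lambda>i. (\<lambda>v. v @ [int k - int i]) ` luk_paths t i n"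
  have "{w \<in> luk_paths t k (Suc n). P (last w)} = (\<Union>i\<in>?I. ?ext i)"
  proof (intro equalityI subsetI)
    fix w assume w: "w \<in> {w \<in> luk_paths t k (Suc n). P (last w)}"
    then have "w \<noteq> []" by (auto simp: luk_paths_def)
    then obtain v j where "w = v @ [j]" by (metis append_butlast_last_id)
    then show "w \<in> (\<Union>i\<in>?I. ?ext i)"
      using w snoc_in_luk_paths_iff[OF assms] by auto
  next
    fix w assume "w \<in> (\<Union>i\<in>?I. ?ext i)"
    then show "w \<in> {w \<in> luk_paths t k (Suc n). P (last w)}"
      using snoc_in_luk_paths_iff[OF assms] by auto
  qed
  also have "card \<dots> = (\<Sum>i\<in>?I. card (?ext i))"
    by (rule card_UN_disjoint) (auto simp: finite_luk_paths)
  also have "\<dots> = (\<Sum>i\<in>?I. card (luk_paths t i n))"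
    by (intro sum.cong refl card_image) (auto simp: inj_on_def)
  finally show ?thesis .
qed

definition path_gf :: "nat \<Rightarrow> nat \<Rightarrow> rat fps" where
  "path_gf t k = Abs_fps (\<lambda>n. of_nat (card (luk_paths t k n)))"

text \<open>
  The form in which the decomposition by last step is used: the predicate \<open>P\<close> singles out
  up-steps, down-steps, horizontal steps, or all steps.
\<close>

lemma gf_by_last_step:
  assumes "k \<le> t"
  shows "Abs_fps (\<lambda>n. of_nat (card {w \<in> luk_paths t k n. w \<noteq> [] \<and> P (last w)})) =
    fps_X * (\<Sum>i | i \<le> k + 1 \<and> P (int k - int i). path_gf t i)"
proof (rule fps_ext)
  fix n
  show "fps_nth (Abs_fps (\<lambda>n. of_nat (card {w \<in> luk_paths t k n. w \<noteq> [] \<and> P (last w)}))) n =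
    fps_nth (fps_X * (\<Sum>i | i \<le> k + 1 \<and> P (int k - int i). path_gf t i)) n"
  proof (cases n)
    case 0
    then show ?thesis by (simp add: luk_paths_length_0)
  next
    case (Suc m)
    have "{w \<in> luk_paths t k n. w \<noteq> [] \<and> P (last w)} = {w \<in> luk_paths t k (Suc m). P (last w)}"
      by (auto simp: luk_paths_def Suc)
    then show ?thesis
      using card_luk_paths_last[OF assms, of m P] by (simp add: Suc fps_sum_nth path_gf_def)
  qed
qed

lemma path_gf_above: "path_gf t (Suc t) = 0"
  by (rule fps_ext) (simp add: path_gf_def luk_paths_above)

lemma path_gf_rec:
  assumes "k \<le> t"
  shows "path_gf t k = (if k = 0 then 1 else 0) + fps_X * (\<Sum>i\<le>k + 1. path_gf t i)"
proof -
  have "path_gf t k = (if k = 0 then 1 else 0) +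
      Abs_fps (\<lambda>n. of_nat (card {w \<in> luk_paths t k n. w \<noteq> [] \<and> True}))"
  proof (rule fps_ext)
    fix n
    have "{w \<in> luk_paths t k n. w \<noteq> []} = luk_paths t k n" if "n \<noteq> 0"
      using that by (auto simp: luk_paths_def)
    then show "fps_nth (path_gf t k) n = fps_nth ((if k = 0 then 1 else 0) +
      Abs_fps (\<lambda>n. of_nat (card {w \<in> luk_paths t k n. w \<noteq> [] \<and> True}))) n"
      by (cases "n = 0") (simp_all add: path_gf_def luk_paths_length_0)
  qed
  also have "\<dots> = (if k = 0 then 1 else 0) + fps_X * (\<Sum>i\<le>k + 1. path_gf t i)"
    using gf_by_last_step[OF assms, of "\<lambda>_. True"] by (simp add: atMost_def)
  finally show ?thesis .
qed

lemma gf_g_eq: "k \<le> t \<Longrightarrow> gf_g k t = fps_X * path_gf t (Suc k)"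
proof -
  assume "k \<le> t"
  moreover have "{i. i \<le> k + 1 \<and> int k - int i = -1} = {Suc k}" by auto
  ultimately show ?thesis
    using gf_by_last_step[of k t "\<lambda>j. j = -1"] by (simp add: gf_g_def)
qed

lemma gf_h_eq: "k \<le> t \<Longrightarrow> gf_h k t = fps_X * path_gf t k"
proof -
  assume "k \<le> t"
  moreover have "{i. i \<le> k + 1 \<and> int k - int i = 0} = {k}" by auto
  ultimately show ?thesis
    using gf_by_last_step[of k t "\<lambda>j. j = 0"] by (simp add: gf_h_def)
qed

lemma gf_f_eq:
  assumes "1 \<le> k" "k \<le> t"
  shows "gf_f k t = fps_X * (\<Sum>i<k. path_gf t i)"
proof -
  \<comment> \<open>The empty path ends at height \<open>0\<close>, so it does not contribute to \<open>gf_f k t\<close>.\<close>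
  have "[] \<notin> luk_paths t k n" for n
    using assms by (simp add: luk_paths_def end_height_eq_sum_list)
  then have "{w \<in> luk_paths t k n. w = [] \<or> 1 \<le> last w} =
      {w \<in> luk_paths t k n. w \<noteq> [] \<and> 1 \<le> last w}" for n
    by metis
  moreover have "{i. i \<le> k + 1 \<and> 1 \<le> int k - int i} = {..<k}" by auto
  ultimately show ?thesis
    using gf_by_last_step[OF assms(2), of "\<lambda>j. 1 \<le> j"] by (simp add: gf_f_def)
qed

section \<open>The polynomials as power series\<close>

lemma fps_of_int_poly_rec:
  "fps_of_int_poly (- p - [:0, 1:] * q) = - fps_of_int_poly p - fps_X * fps_of_int_poly q"
  by (rule fps_ext) (simp add: fps_of_int_poly_def coeff_map_poly coeff_pCons split: nat.split)

lemma fps_of_int_poly_pCons: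
  "fps_of_int_poly (pCons c p) = fps_const (of_int c) + fps_X * fps_of_int_poly p"
  by (simp add: fps_of_int_poly_def map_poly_pCons fps_of_poly_pCons mult.commute)

lemma fps_of_int_poly_0: "fps_of_int_poly 0 = 0"
  by (simp add: fps_of_int_poly_def)

abbreviation "fps_D m \<equiv> fps_of_int_poly (poly_D m)"
abbreviation "fps_N2 m \<equiv> fps_of_int_poly (poly_N2 m)"
abbreviation "fps_N3 m \<equiv> fps_of_int_poly (poly_N3 m)"

lemma fps_initial:
  "fps_D 0 = fps_X - 1" "fps_D (Suc 0) = 1 - 2 * fps_X"
  "fps_N2 0 = 0" "fps_N2 (Suc 0) = fps_X ^ 2"
  "fps_N3 0 = - fps_X" "fps_N3 (Suc 0) = fps_X * (1 - fps_X)"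
  by (simp_all add: fps_of_int_poly_pCons fps_of_int_poly_0 power2_eq_square fps_const_neg[symmetric]
      numeral_fps_const algebra_simps del: fps_const_neg)

lemma fps_rec:
  "fps_D (Suc (Suc m)) = - fps_D (Suc m) - fps_X * fps_D m"
  "fps_N2 (Suc (Suc m)) = - fps_N2 (Suc m) - fps_X * fps_N2 m"
  "fps_N3 (Suc (Suc m)) = - fps_N3 (Suc m) - fps_X * fps_N3 m"
  by (simp_all only: poly_D.simps poly_N2.simps poly_N3.simps fps_of_int_poly_rec)

\<comment> \<open>From here on the polynomials are only known through their recurrence as power series.\<close>
declare poly_D.simps [simp del] poly_N2.simps [simp del] poly_N3.simps [simp del]

text \<open>
  Both sides of a linear relation between \<open>D\<close>, \<open>N2\<close> and \<open>N3\<close> satisfy the common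
  recurrence, so such a relation only has to be checked at the indices \<open>0\<close> and \<open>1\<close>.
\<close>

lemma recurrence_unique:
  fixes a b :: "nat \<Rightarrow> 'a :: comm_ring_1"
  assumes "\<And>m. a (Suc (Suc m)) = - a (Suc m) - x * a m"
    and "\<And>m. b (Suc (Suc m)) = - b (Suc m) - x * b m"
    and "a 0 = b 0" "a (Suc 0) = b (Suc 0)"
  shows "a m = b m"
proof (induction m rule: induct_nat_012)
  case (ge2 m)
  then show ?case by (simp add: assms(1,2))
qed (use assms in auto)

lemma D_from_N2:
  "fps_X ^ 2 * fps_D (Suc m) =
    (1 - 2 * fps_X) * fps_N2 (Suc m) + fps_X * (1 - fps_X) * fps_N2 m"
  by (rule recurrence_unique[where x = fps_X])
    (simp_all add: fps_rec fps_initial algebra_simps power2_eq_square)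

lemma N3_from_N2: "fps_X * fps_N3 m = - fps_N2 (Suc m) - fps_X * fps_N2 m"
  by (rule recurrence_unique[where x = fps_X])
    (simp_all add: fps_rec fps_initial algebra_simps power2_eq_square)

section \<open>Solving the system\<close>

lemma path_gf_three_term:
  assumes "1 \<le> k" "k < t"
  shows "path_gf t k = path_gf t (Suc k) - fps_X * path_gf t (Suc (Suc k))"
proof -
  have "path_gf t (Suc k) = fps_X * (\<Sum>i\<le>k + 1. path_gf t i) + fps_X * path_gf t (Suc (Suc k))"
    using assms by (subst path_gf_rec) (simp_all add: distrib_left)
  also have "fps_X * (\<Sum>i\<le>k + 1. path_gf t i) = path_gf t k"
    using assms by (subst (2) path_gf_rec) simp_all
  finally show ?thesis by (simp add: algebra_simps)
qed

text \<open>
  The index \<open>m = t + 1 - k\<close> counts heights downwards from \<open>t + 1\<close>, where the generating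
  function vanishes like \<open>N2\<close> does at \<open>0\<close>.
\<close>

lemma path_gf_descent:
  assumes "1 \<le> k" "k + m = Suc t"
  shows "fps_X ^ 2 * path_gf t k = (-1) ^ Suc m * fps_N2 m * path_gf t t"
  using assms
proof (induction m arbitrary: k rule: induct_nat_012)
  case 0
  then show ?case by (simp add: path_gf_above fps_initial)
next
  case 1
  then show ?case by (simp add: fps_initial)
next
  case (ge2 m)
  have "fps_X ^ 2 * path_gf t k =
      fps_X ^ 2 * path_gf t (Suc k) - fps_X * (fps_X ^ 2 * path_gf t (Suc (Suc k)))"
    using ge2.prems by (subst path_gf_three_term) (simp_all add: algebra_simps)
  also have "fps_X ^ 2 * path_gf t (Suc k) = (-1) ^ Suc (Suc m) * fps_N2 (Suc m) * path_gf t t"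
    using ge2 by (intro ge2.IH(2)) auto
  also have "fps_X ^ 2 * path_gf t (Suc (Suc k)) = (-1) ^ Suc m * fps_N2 m * path_gf t t"
    using ge2 by (intro ge2.IH(1)) auto
  finally show ?case by (simp add: fps_rec algebra_simps)
qed

text \<open>
  Eliminating \<open>path_gf t 0\<close> from the equations at heights \<open>0\<close> and \<open>1\<close> leaves one
  relation between heights \<open>1\<close> and \<open>2\<close>, which pins down the factor \<open>path_gf t t\<close> of
  the descent.
\<close>

lemma path_gf_top:
  assumes "1 \<le> t"
  shows "fps_D t * path_gf t t = (-1) ^ Suc t * fps_X"
proof -
  let ?s = "path_gf t" and ?X = "fps_X :: rat fps" and ?e = "(-1) ^ t :: rat fps"
  obtain m where t: "t = Suc m" using assms by (cases t) auto
  have "?s 0 = 1 + ?X * (?s 0 + ?s 1)"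
    by (subst path_gf_rec) simp_all
  then have "?s 0 - ?X * ?s 0 = 1 + ?X * (?s 0 + ?s 1) - ?X * ?s 0"
    by (rule arg_cong)
  then have at_0: "(1 - ?X) * ?s 0 = 1 + ?X * ?s 1"
    by (simp add: algebra_simps)
  have "?s 1 = ?X * (?s 0 + ?s 1 + ?s 2)"
    using assms by (subst path_gf_rec) (simp_all add: numeral_2_eq_2)
  then have "?s 1 - ?X * ?s 1 = ?X * (?s 0 + ?s 1 + ?s 2) - ?X * ?s 1"
    by (rule arg_cong)
  then have "(1 - ?X) * ?s 1 = ?X * ?s 0 + ?X * ?s 2"
    by (simp add: algebra_simps)
  then have "(1 - ?X) * ((1 - ?X) * ?s 1) = ?X * ((1 - ?X) * ?s 0) + ?X * (1 - ?X) * ?s 2"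
    by (simp only: distrib_left mult_ac)
  then have rel: "(1 - 2 * ?X) * ?s 1 = ?X + ?X * (1 - ?X) * ?s 2"
    unfolding at_0 by (simp add: algebra_simps)
  have s1: "?X ^ 2 * ?s 1 = - ?e * fps_N2 t * ?s t"
    using assms path_gf_descent[of 1 t t] by simp
  have s2: "?X ^ 2 * ?s 2 = ?e * fps_N2 m * ?s t"
    using path_gf_descent[of 2 m t] t by simp
  have D: "?X ^ 2 * fps_D t = (1 - 2 * ?X) * fps_N2 t + ?X * (1 - ?X) * fps_N2 m"
    unfolding t by (rule D_from_N2)
  have "(1 - 2 * ?X) * (?X ^ 2 * ?s 1) = ?X ^ 2 * ((1 - 2 * ?X) * ?s 1)"
    by (simp only: mult_ac)
  also have "\<dots> = ?X ^ 2 * ?X + ?X * (1 - ?X) * (?X ^ 2 * ?s 2)"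
    unfolding rel by (simp only: distrib_left mult_ac)
  finally have "?e * ((1 - 2 * ?X) * fps_N2 t + ?X * (1 - ?X) * fps_N2 m) * ?s t = - (?X ^ 2 * ?X)"
    unfolding s1 s2 by (simp add: algebra_simps)
  then have "?X ^ 2 * (?e * fps_D t * ?s t) = ?X ^ 2 * (- ?X)"
    unfolding D[symmetric] by (simp add: mult_ac)
  then have "?e * fps_D t * ?s t = - ?X"
    by (subst (asm) mult_left_cancel) simp_all
  then have "?e * (?e * fps_D t * ?s t) = ?e * (- ?X)"
    by (rule arg_cong)
  moreover have "?e * ?e = 1" by (simp flip: power_mult_distrib)
  ultimately show ?thesis by (simp flip: mult.assoc)
qed

lemma path_gf_closed_form:
  assumes "1 \<le> k" "k + m = Suc t" "1 \<le> t"
  shows "fps_X * path_gf t k * fps_D t = (-1) ^ Suc k * fps_N2 m"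
proof -
  have sign: "(-1) ^ Suc m * (-1) ^ Suc t = ((-1) ^ Suc k :: rat fps)"
  proof -
    have "even (Suc m + Suc t) \<longleftrightarrow> even (Suc k)" using assms(2) by presburger
    then show ?thesis by (metis power_add minus_one_power_iff)
  qed
  have "fps_X * (fps_X * path_gf t k * fps_D t) = fps_X ^ 2 * path_gf t k * fps_D t"
    by (simp add: power2_eq_square)
  also have "\<dots> = (-1) ^ Suc m * fps_N2 m * (fps_D t * path_gf t t)"
    using assms path_gf_descent by (simp add: mult_ac)
  also have "\<dots> = fps_X * (((-1) ^ Suc m * (-1) ^ Suc t) * fps_N2 m)"
    unfolding path_gf_top[OF assms(3)] by (simp only: mult_ac)
  finally have "fps_X * (fps_X * path_gf t k * fps_D t) = fps_X * ((-1) ^ Suc k * fps_N2 m)"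
    unfolding sign .
  then show ?thesis by (subst (asm) mult_left_cancel) simp_all
qed

lemma eq_mult_divide_fps_D:
  assumes "F * fps_D t = c * A"
  shows "F = c * (A / fps_D t)"
proof -
  have "c * (A / fps_D t) = F * (fps_D t * inverse (fps_D t))"
    using assms by (simp add: fps_divide_unit fps_nth_poly_D_0 flip: mult.assoc)
  then show ?thesis by (simp add: inverse_mult_eq_1' fps_nth_poly_D_0)
qed

theorem theorem3:
  fixes k t :: nat
  assumes "2 \<le> k" and "k \<le> t"
  shows "gf_f k t = (-1) ^ (k - 1) * (fps_of_int_poly (poly_N3 (t - k + 1)) / fps_of_int_poly (poly_D t))
    \<and> gf_g k t = (-1) ^ k * (fps_of_int_poly (poly_N2 (t - k)) / fps_of_int_poly (poly_D t))
    \<and> gf_h k t = (-1) ^ (k - 1) * (fps_of_int_poly (poly_N2 (t - k + 1)) / fps_of_int_poly (poly_D t))"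
proof (intro conjI eq_mult_divide_fps_D)
  let ?m = "t - k + 1" and ?s = "path_gf t" and ?X = "fps_X :: rat fps"
  obtain l where k: "k = Suc l" and "1 \<le> l" using assms by (cases k) auto
  have below: "?X * ?s l * fps_D t = (-1) ^ k * fps_N2 (Suc ?m)"
    using assms \<open>1 \<le> l\<close> k path_gf_closed_form[of l "Suc ?m" t] by simp
  have at: "?X * ?s k * fps_D t = (-1) ^ (k - 1) * fps_N2 ?m"
    using assms k path_gf_closed_form[of k ?m t] by simp
  have above: "?X * ?s (Suc k) * fps_D t = (-1) ^ k * fps_N2 (t - k)"
    using assms k path_gf_closed_form[of "Suc k" "t - k" t] by simp
  show "gf_g k t * fps_D t = (-1) ^ k * fps_N2 (t - k)"
    using above assms by (simp add: gf_g_eq)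
  show "gf_h k t * fps_D t = (-1) ^ (k - 1) * fps_N2 ?m"
    using at assms by (simp add: gf_h_eq)
  \<comment> \<open>Height \<open>k - 1\<close> is at least \<open>1\<close>, so the equation at \<open>k - 1\<close> has no
    contribution from the empty path.\<close>
  have "?s l = ?X * (\<Sum>i<k. ?s i) + ?X * ?s k"
    using assms k \<open>1 \<le> l\<close>
    by (subst path_gf_rec) (simp_all add: lessThan_Suc_atMost distrib_left)
  then have "gf_f k t = ?s l - ?X * ?s k"
    using gf_f_eq[of k t] assms by simp
  then have "?X * (gf_f k t * fps_D t) = ?X * ?s l * fps_D t - ?X * (?X * ?s k * fps_D t)"
    by (simp only: left_diff_distrib right_diff_distrib mult_ac)
  also have "\<dots> = (-1) ^ (k - 1) * (- fps_N2 (Suc ?m) - ?X * fps_N2 ?m)"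
    unfolding below at by (simp add: k algebra_simps)
  also have "\<dots> = ?X * ((-1) ^ (k - 1) * fps_N3 ?m)"
    unfolding N3_from_N2[symmetric] by (simp only: mult_ac)
  finally show "gf_f k t * fps_D t = (-1) ^ (k - 1) * fps_N3 ?m"
    by (subst (asm) mult_left_cancel) simp_all
qed

end
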